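(* Let $\Omega^{(3)}$ be the set of all unordered triples $\{a,b,c\}$ of distinct elements of $\Omega$. (i) The group $W(D_6)$ acts on $\Omega^{(3)}$ diagonally via $g.\{a,b,c\}=\{g.a,g.b,g.c\}$. (ii) If $\{a_1,a_2,a_3\}$ and $\{b_1,b_2,b_3\}$ are two elements of $\Omega^{(3)}$ for which $d(a_i,a_j)=d(b_i,b_j)$ for all $i,j\in\{1,2,3\}$, then there exists $w\in W(D_6)$ such that $w(a_i)=b_i$ for all $i\in\{1,2,3\}$. (iii) Two elements $\{a,b,c\}$ and $\{a',b',c'\}$ of $\Omega^{(3)}$ are in the same $W(D_6)$-orbit if and only if the unordered multisets $\{d(a,b),d(b,c),d(a,c)\}$ and $\{d(a',b'),d(b',c'),d(a',c')\}$ are equal. (iv) The group $W(D_6)$ has precisely $5$ orbits in its action on $\Omega^{(3)}$. These correspond to the multisets $\{2,2,2\}$, $\{4,2,2\}$, $\{4,4,2\}$, $\{4,4,4\}$ and $\{6,4,2\}$.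
   Context: $\Omega$ is the set of the $32$ vectors $(\pm1,\pm1,\pm1,\pm1,\pm1,\pm1)^T$ having an even number of entries $-1$. The Hamming distance $d(\omega_1,\omega_2)$ between $\omega_1,\omega_2\in\Omega$ is the number of coordinates at which they disagree. $W(D_6)$, the Coxeter group of type $D_6$, is identified with the group of all $6\times6$ monomial matrices with entries in $\{+1,-1,0\}$ having an even number of entries equal to $-1$; it acts on $\Omega$ by matrix multiplication. (In terms of Coxeter generators $s_{1'},s_1,\dots,s_5$, where $s_1,\dots,s_5$ form a chain and $s_{1'}$ is joined only to $s_2$: $s_i$ is the permutation matrix of the transposition $(i,i+1)$ and $s_{1'}$ sends $(x_1,x_2,x_3,\dots,x_6)^T$ to $(-x_2,-x_1,x_3,\dots,x_6)^T$.) *)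

theory Defs
  imports "HOL-Analysis.Determinants" "HOL-Algebra.Group_Action" "HOL-Library.Multiset"
begin

definition Omega :: "(real^6) set" where
  "Omega = {x. (\<forall>i. x $ i = 1 \<or> x $ i = -1) \<and> even (card {i. x $ i = -1})}"

definition hamming :: "real^6 \<Rightarrow> real^6 \<Rightarrow> nat" where
  "hamming x y = card {i. x $ i \<noteq> y $ i}"

definition monomial_matrix :: "real^6^6 \<Rightarrow> bool" where
  "monomial_matrix A \<longleftrightarrow> (\<forall>i. \<exists>!j. A $ i $ j \<noteq> 0) \<and> (\<forall>j. \<exists>!i. A $ i $ j \<noteq> 0)"

text \<open>The Coxeter group of type $D_6$ in its realisation by signed permutation matrices.\<close>

definition WD6 :: "(real^6^6) monoid" where
  "WD6 = \<lparr>carrier = {A. monomial_matrix A \<and> (\<forall>i j. A $ i $ j \<in> {1, -1, 0})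
                         \<and> even (card {(i, j). A $ i $ j = -1})},
          mult = (**), one = mat 1\<rparr>"

definition Omega3 :: "(real^6) set set" where
  "Omega3 = {T. T \<subseteq> Omega \<and> card T = 3}"

text \<open>Restricted to \<^term>\<open>Omega3\<close>, since the elements of \<^term>\<open>BijGroup Omega3\<close> are extensional functions.\<close>

definition diag_action :: "real^6^6 \<Rightarrow> (real^6) set \<Rightarrow> (real^6) set" where
  "diag_action g = (\<lambda>T\<in>Omega3. (\<lambda>x. g *v x) ` T)"

end

theory Submission
  imports Defs
begin

text \<open>A signed permutation taking \<open>a\<^sub>1\<close> to \<open>b\<^sub>1\<close> is
  determined by the underlying permutation of coordinates, and its signs multiply to \<open>1\<close>
  automatically since the entries of \<open>a\<^sub>1\<close> and of \<open>b\<^sub>1\<close> do. It takes \<open>a\<^sub>2\<close> to \<open>b\<^sub>2\<close> and \<open>a\<^sub>3\<close> to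
  \<open>b\<^sub>3\<close> as soon as the permutation respects, for each coordinate, whether the second and
  the third vector disagree there with the first one. The pairwise distances determine how
  many coordinates have each of these four patterns, so such a permutation exists.\<close>

section \<open>Parity of the number of minus signs, expressed by products\<close>

lemma prod_signs:
  fixes f :: "'n::finite \<Rightarrow> real"
  assumes "\<And>i. f i = 1 \<or> f i = -1"
  shows "prod f UNIV = (-1) ^ card {i. f i = -1}"
proof -
  have "prod f UNIV = (\<Prod>i\<in>UNIV. if f i = -1 then -1 else 1)"
    by (rule prod.cong) (use assms in auto)
  also have "\<dots> = (-1) ^ card {i. f i = -1}"
    by (simp add: prod.If_cases)
  finally show ?thesis .
qed

lemma prod_signs_eq_1_iff:
  fixes f :: "'n::finite \<Rightarrow> real"
  assumes "\<And>i. f i = 1 \<or> f i = -1"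
  shows "prod f UNIV = 1 \<longleftrightarrow> even (card {i. f i = -1})"
  by (simp add: prod_signs[OF assms] minus_one_power_iff)

text \<open>A product of signs is 1 exactly when the number of its factors -1 is even. In this form
  the parity condition is multiplicative and can be reindexed along a bijection, which replaces
  counting of minus signs in the arguments below.\<close>

lemma mem_Omega_iff:
  "x \<in> Omega \<longleftrightarrow> (\<forall>i. x $ i = 1 \<or> x $ i = -1) \<and> (\<Prod>i\<in>UNIV. x $ i) = 1"
  using prod_signs_eq_1_iff[of "\<lambda>i. x $ i"] by (auto simp: Omega_def)

text \<open>The coordinatewise product of \<open>x\<close> and \<open>y\<close> has the entry -1
  exactly where they disagree, and its entries multiply to 1 because those of \<open>x\<close> and
  of \<open>y\<close> do.\<close>

lemma even_hamming:
  assumes "x \<in> Omega" "y \<in> Omega"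
  shows "even (hamming x y)"
proof -
  have sg: "\<And>i. x $ i = 1 \<or> x $ i = -1" "\<And>i. y $ i = 1 \<or> y $ i = -1"
    using assms by (auto simp: mem_Omega_iff)
  have sgxy: "\<And>i. x $ i * y $ i = 1 \<or> x $ i * y $ i = -1"
    using sg by (metis mult_minus1 mult_minus1_right mult_1 minus_minus)
  have "(\<Prod>i\<in>UNIV. x $ i * y $ i) = 1"
    using assms by (simp add: mem_Omega_iff prod.distrib)
  then have "even (card {i. x $ i * y $ i = -1})"
    using prod_signs_eq_1_iff[of "\<lambda>i. x $ i * y $ i", OF sgxy] by simp
  moreover have "x $ i * y $ i = -1 \<longleftrightarrow> x $ i \<noteq> y $ i" for i
    using sg(1)[of i] sg(2)[of i] by auto
  ultimately show ?thesis by (simp add: hamming_def)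
qed

lemma hamming_commute: "hamming x y = hamming y x"
  by (simp add: hamming_def eq_commute)

lemma hamming_eq_0_iff: "hamming x y = 0 \<longleftrightarrow> x = y"
  by (auto simp: hamming_def vec_eq_iff)

subsection \<open>Signed permutation matrices\<close>

text \<open>The only nonzero entry of row \<open>i\<close> stands in column \<open>p i\<close>, so
  coordinate \<open>i\<close> of the image is read off from coordinate \<open>p i\<close> of the
  argument. Hence permutations compose in reverse order under matrix multiplication.\<close>

definition signed_perm :: "('n \<Rightarrow> 'n) \<Rightarrow> ('n \<Rightarrow> real) \<Rightarrow> real^'n^'n" where
  "signed_perm p e = (\<chi> i j. if j = p i then e i else 0)"

lemma signed_perm_mult_vec: "signed_perm p e *v x = (\<chi> i. e i * x $ p i)"
  by (simp add: vec_eq_iff signed_perm_def matrix_vector_mult_def if_distrib[of "\<lambda>z. z * _"]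
      sum.delta cong: if_cong)

lemma signed_perm_mult:
  "signed_perm p e ** signed_perm q f = signed_perm (q \<circ> p) (\<lambda>i. e i * f (p i))"
  unfolding matrix_eq
  by (simp add: matrix_vector_mul_assoc[symmetric] signed_perm_mult_vec mult.assoc)

lemma signed_perm_id: "signed_perm id (\<lambda>_. 1) = mat 1"
  by (auto simp: signed_perm_def mat_def vec_eq_iff)

lemma signed_perm_in_WD6:
  assumes "bij p" "\<And>i. e i = 1 \<or> e i = -1" "prod e UNIV = 1"
  shows "signed_perm p e \<in> carrier WD6"
proof -
  have nz: "signed_perm p e $ i $ j \<noteq> 0 \<longleftrightarrow> j = p i" for i j
    using assms(2)[of i] by (auto simp: signed_perm_def)
  have "monomial_matrix (signed_perm p e)"
    unfolding monomial_matrix_def nz using assms(1) by (auto simp: bij_iff eq_commute)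
  moreover have "signed_perm p e $ i $ j \<in> {1, -1, 0}" for i j
    using assms(2)[of i] by (auto simp: signed_perm_def)
  moreover have "card {(i, j). signed_perm p e $ i $ j = -1} = card {i. e i = -1}"
  proof -
    have "{(i, j). signed_perm p e $ i $ j = -1} = (\<lambda>i. (i, p i)) ` {i. e i = -1}"
      by (auto simp: signed_perm_def split: if_splits)
    then show ?thesis by (simp add: card_image inj_on_def)
  qed
  ultimately show ?thesis
    using prod_signs_eq_1_iff[of e, OF assms(2)] assms(3) by (simp add: WD6_def)
qed

text \<open>Take \<open>p i\<close> to be the column of the unique nonzero entry of row
  \<open>i\<close>; uniqueness in each column makes \<open>p\<close> bijective. There is one sign
  per row, so the parity of the number of entries -1 turns into the product of the signs.\<close>

lemma WD6_signed_permE: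
  assumes "g \<in> carrier WD6"
  obtains p e where "g = signed_perm p e" "bij p" "\<And>i. e i = 1 \<or> e i = -1" "prod e UNIV = 1"
proof -
  have mono: "\<And>i. \<exists>!j. g $ i $ j \<noteq> 0" "\<And>j. \<exists>!i. g $ i $ j \<noteq> 0"
    and ent: "\<And>i j. g $ i $ j \<in> {1, -1, 0}"
    and ev: "even (card {(i, j). g $ i $ j = -1})"
    using assms by (auto simp: WD6_def monomial_matrix_def)
  obtain p where p: "\<And>i j. g $ i $ j \<noteq> 0 \<longleftrightarrow> j = p i"
    using mono(1) by metis
  define e where "e i = g $ i $ p i" for i
  have g: "g = signed_perm p e"
    using p by (auto simp: vec_eq_iff signed_perm_def e_def)
  have b: "bij p"
    using mono(2) unfolding p bij_iff by metis
  have e: "e i = 1 \<or> e i = -1" for i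
    using ent[of i "p i"] p[of i "p i"] by (auto simp: e_def)
  have "{(i, j). g $ i $ j = -1} = (\<lambda>i. (i, p i)) ` {i. e i = -1}"
    unfolding g by (auto simp: signed_perm_def split: if_splits)
  then have "card {(i, j). g $ i $ j = -1} = card {i. e i = -1}"
    by (simp add: card_image inj_on_def)
  with ev have "prod e UNIV = 1"
    using prod_signs_eq_1_iff[of e, OF e] by simp
  with g b e that show ?thesis by blast
qed

section \<open>Group structure of the signed permutation matrices\<close>

lemma WD6_mult_closed:
  assumes "g \<in> carrier WD6" "h \<in> carrier WD6"
  shows "g ** h \<in> carrier WD6"
proof -
  obtain p e where g: "g = signed_perm p e" "bij p" "\<And>i. e i = 1 \<or> e i = -1" "prod e UNIV = 1"
    using WD6_signed_permE[OF assms(1)] by blast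
  obtain q f where h: "h = signed_perm q f" "bij q" "\<And>i. f i = 1 \<or> f i = -1" "prod f UNIV = 1"
    using WD6_signed_permE[OF assms(2)] by blast
  have "(\<Prod>i\<in>UNIV. e i * f (p i)) = 1"
    using prod.reindex_bij_betw[OF g(2), of f] g(4) h(4) by (simp add: prod.distrib)
  moreover have "e i * f (p i) = 1 \<or> e i * f (p i) = -1" for i
    using g(3)[of i] h(3)[of "p i"] by auto
  ultimately show ?thesis
    unfolding g(1) h(1) signed_perm_mult
    by (intro signed_perm_in_WD6 bij_comp g(2) h(2))
qed

lemma WD6_one_closed: "mat 1 \<in> carrier WD6"
  unfolding signed_perm_id[symmetric] by (rule signed_perm_in_WD6) auto

lemma WD6_left_inverse:
  assumes "g \<in> carrier WD6"
  obtains h where "h \<in> carrier WD6" "h ** g = mat 1"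
proof -
  obtain p e where g: "g = signed_perm p e" "bij p" "\<And>i. e i = 1 \<or> e i = -1" "prod e UNIV = 1"
    using WD6_signed_permE[OF assms] by blast
  define q where "q = inv_into UNIV p"
  \<comment> \<open>The sign \<open>e (q i)\<close> is chosen so that the signs of
    \<open>?h ** g\<close> are the squares \<open>e (q i) * e (q i)\<close>, which are 1.\<close>
  let ?h = "signed_perm q (\<lambda>i. e (q i))"
  have q: "bij q" "p \<circ> q = id"
    using g(2) by (simp_all add: q_def bij_imp_bij_inv bij_is_surj flip: surj_iff)
  have "(\<Prod>i\<in>UNIV. e (q i)) = 1"
    using prod.reindex_bij_betw[OF q(1), of e] g(4) by simp
  then have "?h \<in> carrier WD6"
    using signed_perm_in_WD6[OF q(1), of "\<lambda>i. e (q i)"] g(3) by blast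
  moreover have "e i * e i = 1" for i
    using g(3)[of i] by auto
  then have "?h ** g = mat 1"
    by (simp add: g(1) signed_perm_mult q(2) flip: signed_perm_id)
  ultimately show ?thesis by (rule that)
qed

lemma WD6_simps: "x \<otimes>\<^bsub>WD6\<^esub> y = x ** y" "\<one>\<^bsub>WD6\<^esub> = mat 1"
  by (simp_all add: WD6_def)

lemma group_WD6: "group WD6"
proof (rule groupI)
  show "\<exists>y\<in>carrier WD6. y \<otimes>\<^bsub>WD6\<^esub> x = \<one>\<^bsub>WD6\<^esub>" if "x \<in> carrier WD6" for x
    using WD6_left_inverse[OF that] unfolding WD6_simps by blast
qed (simp_all add: WD6_simps WD6_mult_closed WD6_one_closed matrix_mul_assoc)

section \<open>Action on vectors and on triples\<close>

lemma WD6_Omega: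
  assumes "g \<in> carrier WD6" "x \<in> Omega"
  shows "g *v x \<in> Omega"
proof -
  obtain p e where g: "g = signed_perm p e" "bij p" "\<And>i. e i = 1 \<or> e i = -1" "prod e UNIV = 1"
    using WD6_signed_permE[OF assms(1)] by blast
  \<comment> \<open>The product splits into the product of the signs and, after reindexing along
    \<open>p\<close>, the product of the entries of \<open>x\<close>; both are 1.\<close>
  have "(\<Prod>i\<in>UNIV. e i * x $ p i) = 1"
    using prod.reindex_bij_betw[OF g(2), of "\<lambda>i. x $ i"] g(4) assms(2)
    by (simp add: prod.distrib mem_Omega_iff)
  moreover have "e i * x $ p i = 1 \<or> e i * x $ p i = -1" for i
    using g(3)[of i] assms(2) by (auto simp: mem_Omega_iff)
  ultimately show ?thesis by (simp add: mem_Omega_iff g(1) signed_perm_mult_vec)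
qed

text \<open>Multiplying a coordinate of both vectors by the same nonzero sign neither creates nor
  removes a disagreement. So the disagreement set of the images is the preimage under
  \<open>p\<close> of the original one, and \<open>p\<close> is bijective.\<close>

lemma WD6_hamming:
  assumes "g \<in> carrier WD6"
  shows "hamming (g *v x) (g *v y) = hamming x y"
proof -
  obtain p e where g: "g = signed_perm p e" "bij p" "\<And>i. e i = 1 \<or> e i = -1" "prod e UNIV = 1"
    using WD6_signed_permE[OF assms] by blast
  have "e i \<noteq> 0" for i using g(3)[of i] by auto
  then have "{i. (g *v x) $ i \<noteq> (g *v y) $ i} = p -` {i. x $ i \<noteq> y $ i}"
    by (auto simp: g(1) signed_perm_mult_vec)
  moreover have "card (p -` {i. x $ i \<noteq> y $ i}) = card {i. x $ i \<noteq> y $ i}"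
    using g(2) by (intro card_vimage_inj) (auto simp: bij_def)
  ultimately show ?thesis by (simp add: hamming_def)
qed

text \<open>Distance 0 characterises equality, so preserving distances forces injectivity.\<close>

lemma WD6_inj:
  assumes "g \<in> carrier WD6"
  shows "inj ((*v) g)"
  using WD6_hamming[OF assms] by (metis hamming_eq_0_iff injI)

lemma WD6_Omega3:
  assumes "g \<in> carrier WD6" "T \<in> Omega3"
  shows "(*v) g ` T \<in> Omega3"
  using assms WD6_Omega card_image[OF inj_on_subset[OF WD6_inj[OF assms(1)]], of T]
  by (auto simp: Omega3_def)

lemma group_action_Omega3: "group_action WD6 Omega3 diag_action"
proof -
  have comp: "diag_action g (diag_action h T) = diag_action (g ** h) T"
    if "h \<in> carrier WD6" "T \<in> Omega3" for g h T
    using that WD6_Omega3 by (simp add: diag_action_def image_image matrix_vector_mul_assoc)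
  have one: "diag_action (mat 1) T = T" if "T \<in> Omega3" for T
    using that by (simp add: diag_action_def)
  \<comment> \<open>Equality with a composition in \<open>BijGroup Omega3\<close> is an equality of
    total functions, so the default value outside \<open>Omega3\<close> has to match as
    well.\<close>
  have undef: "diag_action g T = undefined" if "T \<notin> Omega3" for g T
    using that by (simp add: diag_action_def)
  have mem: "diag_action g T \<in> Omega3" if "g \<in> carrier WD6" "T \<in> Omega3" for g T
    using that WD6_Omega3 by (simp add: diag_action_def)
  have Bij: "diag_action g \<in> Bij Omega3" if g: "g \<in> carrier WD6" for g
  proof -
    obtain h where h: "h \<in> carrier WD6" "h ** g = mat 1"
      using WD6_left_inverse[OF g] .
    \<comment> \<open>For square matrices a one-sided inverse is two-sided; both sides are needed
      for \<open>diag_action h\<close> to witness bijectivity.\<close>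
    then have "g ** h = mat 1" by (simp add: matrix_left_right_inverse)
    then have "diag_action h (diag_action g T) = T" "diag_action g (diag_action h T) = T"
      if "T \<in> Omega3" for T
      using comp[OF g that, of h] comp[OF h(1) that, of g] one[OF that] h(2) by simp_all
    then have "bij_betw (diag_action g) Omega3 Omega3"
      by (intro bij_betw_byWitness[where f' = "diag_action h"])
        (simp_all add: image_subset_iff mem g h(1))
    then show ?thesis by (simp add: Bij_def diag_action_def)
  qed
  have "diag_action \<in> hom WD6 (BijGroup Omega3)"
  proof (rule homI)
    show "diag_action (g \<otimes>\<^bsub>WD6\<^esub> h) = diag_action g \<otimes>\<^bsub>BijGroup Omega3\<^esub> diag_action h"
      if "g \<in> carrier WD6" "h \<in> carrier WD6" for g h
    proof -
      have "diag_action (g ** h) = compose Omega3 (diag_action g) (diag_action h)"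
        by (rule ext) (simp add: compose_def comp[OF that(2)] undef)
      then show ?thesis
        using Bij that by (simp add: BijGroup_def WD6_simps)
    qed
  qed (simp add: BijGroup_def Bij)
  then show ?thesis
    by (intro group_action.intro group_hom.intro group_hom_axioms.intro group_WD6 group_BijGroup)
qed

subsection \<open>Disagreement patterns\<close>

definition disagreement :: "real^6 \<Rightarrow> real^6 \<Rightarrow> real^6 \<Rightarrow> 6 \<Rightarrow> bool \<times> bool" where
  "disagreement a b c i = (b $ i \<noteq> a $ i, c $ i \<noteq> a $ i)"

text \<open>Entries are signs, so \<open>b\<close> and \<open>c\<close> differ at a coordinate
  exactly when one of them, but not both, differs from \<open>a\<close> there. The result is a
  nonsingular system of four linear equations in the four pattern counts, so the distances determine
  the counts.\<close>

lemma card_disagreement: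
  assumes "a \<in> Omega" "b \<in> Omega" "c \<in> Omega"
  defines "n \<equiv> \<lambda>v. card {i. disagreement a b c i = v}"
  shows "hamming a b = n (True, True) + n (True, False)"
    and "hamming a c = n (True, True) + n (False, True)"
    and "hamming b c = n (True, False) + n (False, True)"
    and "n (True, True) + n (True, False) + n (False, True) + n (False, False) = 6"
proof -
  let ?S = "\<lambda>v. {i. disagreement a b c i = v}"
  have sg: "a $ i = 1 \<or> a $ i = -1" "b $ i = 1 \<or> b $ i = -1" "c $ i = 1 \<or> c $ i = -1" for i
    using assms(1-3) by (auto simp: mem_Omega_iff)
  have U: "card (?S v \<union> ?S w) = n v + n w" if "v \<noteq> w" for v w
    unfolding n_def using that by (intro card_Un_disjoint) auto
  have "{i. a $ i \<noteq> b $ i} = ?S (True, True) \<union> ?S (True, False)"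
    by (auto simp: disagreement_def)
  then show "hamming a b = n (True, True) + n (True, False)"
    by (simp add: hamming_def U)
  have "{i. a $ i \<noteq> c $ i} = ?S (True, True) \<union> ?S (False, True)"
    by (auto simp: disagreement_def)
  then show "hamming a c = n (True, True) + n (False, True)"
    by (simp add: hamming_def U)
  have "b $ i \<noteq> c $ i \<longleftrightarrow> (b $ i \<noteq> a $ i) \<noteq> (c $ i \<noteq> a $ i)" for i
    using sg(1)[of i] sg(2)[of i] sg(3)[of i] by auto
  then have "{i. b $ i \<noteq> c $ i} = ?S (True, False) \<union> ?S (False, True)"
    by (auto simp: disagreement_def)
  then show "hamming b c = n (True, False) + n (False, True)"
    by (simp add: hamming_def U)
  have pairs: "(UNIV :: (bool \<times> bool) set) = {(True, True), (True, False), (False, True), (False, False)}"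
    by auto
  have "(\<Sum>v\<in>UNIV. n v) = card (\<Union>v\<in>UNIV. ?S v)"
    unfolding n_def by (rule card_UN_disjoint[symmetric]) auto
  also have "(\<Union>v\<in>UNIV. ?S v) = UNIV" by auto
  finally show "n (True, True) + n (True, False) + n (False, True) + n (False, False) = 6"
    by (simp add: pairs add_ac)
qed

lemma WD6_transitive:
  assumes a: "a1 \<in> Omega" "a2 \<in> Omega" "a3 \<in> Omega"
    and b: "b1 \<in> Omega" "b2 \<in> Omega" "b3 \<in> Omega"
    and d: "hamming a1 a2 = hamming b1 b2" "hamming a1 a3 = hamming b1 b3"
      "hamming a2 a3 = hamming b2 b3"
  obtains w where "w \<in> carrier WD6" "w *v a1 = b1" "w *v a2 = b2" "w *v a3 = b3"
proof -
  let ?A = "disagreement a1 a2 a3" and ?B = "disagreement b1 b2 b3"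
  \<comment> \<open>Both families of counts solve the same linear system, which has only one
    solution.\<close>
  have card_eq: "card {i. ?B i = v} = card {i. ?A i = v}" for v
    using card_disagreement[OF a] card_disagreement[OF b] d
    by (cases v; cases "fst v"; cases "snd v") simp_all
  \<comment> \<open>Equal counts for every pattern are an equality of multisets of values, and this
    is what yields a permutation matching the patterns.\<close>
  have "image_mset ?B (mset_set UNIV) = image_mset ?A (mset_set UNIV)"
  proof (rule multiset_eqI)
    show "count (image_mset ?B (mset_set UNIV)) v = count (image_mset ?A (mset_set UNIV)) v" for v
      using card_eq[of v] by (simp add: count_image_mset' eq_commute)
  qed
  then obtain p where p: "p permutes UNIV" "\<forall>i\<in>UNIV. ?B i = ?A (p i)"
    using image_mset_eq_implies_permutes[of UNIV ?B ?A] by auto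
  have bij: "bij p" using p(1) by (rule permutes_bij)
  have sgA: "a1 $ i = 1 \<or> a1 $ i = -1" "a2 $ i = 1 \<or> a2 $ i = -1" "a3 $ i = 1 \<or> a3 $ i = -1" for i
    using a by (auto simp: mem_Omega_iff)
  have sgB: "b1 $ i = 1 \<or> b1 $ i = -1" "b2 $ i = 1 \<or> b2 $ i = -1" "b3 $ i = 1 \<or> b3 $ i = -1" for i
    using b by (auto simp: mem_Omega_iff)
  \<comment> \<open>This sign is forced by the requirement that \<open>a1\<close> go to
    \<open>b1\<close>, since each entry of \<open>a1\<close> is its own inverse.\<close>
  define e where "e i = b1 $ i * a1 $ p i" for i
  have "e i = 1 \<or> e i = -1" for i
    using sgA(1)[of "p i"] sgB(1)[of i] by (auto simp: e_def)
  moreover have "prod e UNIV = 1"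
    using prod.reindex_bij_betw[OF bij, of "\<lambda>i. a1 $ i"] a(1) b(1)
    by (simp add: e_def prod.distrib mem_Omega_iff)
  ultimately have w: "signed_perm p e \<in> carrier WD6"
    by (intro signed_perm_in_WD6 bij)
  have pat: "b2 $ i \<noteq> b1 $ i \<longleftrightarrow> a2 $ p i \<noteq> a1 $ p i" "b3 $ i \<noteq> b1 $ i \<longleftrightarrow> a3 $ p i \<noteq> a1 $ p i" for i
    using p(2) by (auto simp: disagreement_def)
  have "e i * a1 $ p i = b1 $ i" for i
    using sgA(1)[of "p i"] by (auto simp: e_def)
  \<comment> \<open>Either the second vectors agree with the first ones at the matched coordinates,
    or both are their negatives; the same sign works in both cases.\<close>
  moreover have "e i * a2 $ p i = b2 $ i" for i
    using sgA(1,2)[of "p i"] sgB(1,2)[of i] pat(1)[of i] by (auto simp: e_def)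
  moreover have "e i * a3 $ p i = b3 $ i" for i
    using sgA(1,3)[of "p i"] sgB(1,3)[of i] pat(2)[of i] by (auto simp: e_def)
  ultimately show ?thesis
    using that[OF w] by (simp add: signed_perm_mult_vec vec_eq_iff)
qed

subsection \<open>Distance multisets\<close>

definition distances :: "real^6 \<Rightarrow> real^6 \<Rightarrow> real^6 \<Rightarrow> nat multiset" where
  "distances a b c = {#hamming a b, hamming b c, hamming a c#}"

lemma triple_in_Omega3_iff:
  "{a, b, c} \<in> Omega3 \<longleftrightarrow>
     a \<in> Omega \<and> b \<in> Omega \<and> c \<in> Omega \<and> a \<noteq> b \<and> b \<noteq> c \<and> a \<noteq> c"
  by (auto simp: Omega3_def card_insert_if)

lemma Omega3_tripleE:
  assumes "T \<in> Omega3"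
  obtains a b c where "T = {a, b, c}"
  using assms by (auto simp: Omega3_def card_3_iff)

text \<open>Distinctness makes the two listings permutations of each other. Permuting the vertices
  only permutes the three sides, whose lengths are symmetric in their endpoints.\<close>

lemma distances_cong:
  assumes "{a, b, c} \<in> Omega3" "{a, b, c} = {a', b', c'}"
  shows "distances a b c = distances a' b' c'"
proof -
  have "a \<noteq> b" "b \<noteq> c" "a \<noteq> c"
    using assms(1) by (simp_all add: triple_in_Omega3_iff)
  moreover have "a' \<noteq> b'" "b' \<noteq> c'" "a' \<noteq> c'"
    using assms by (simp_all add: triple_in_Omega3_iff)
  moreover have "a' \<in> {a, b, c}" "b' \<in> {a, b, c}" "c' \<in> {a, b, c}"
    using assms(2) by simp_all
  ultimately show ?thesis
    by (elim insertE emptyE)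
      (simp_all add: distances_def hamming_commute add_mset_commute)
qed

lemma distances_mult:
  "g \<in> carrier WD6 \<Longrightarrow> distances (g *v a) (g *v b) (g *v c) = distances a b c"
  by (simp add: distances_def WD6_hamming)

lemma mset_pair_eq_cases:
  assumes "{#u, v#} = {#u', v'#}"
  obtains "u = u'" "v = v'" | "u = v'" "v = u'"
proof -
  have "u \<in># {#u', v'#}" unfolding assms[symmetric] by simp
  then show ?thesis using assms that by (auto simp: add_mset_commute)
qed

text \<open>The element \<open>x\<close> must be one of the three on the right, and cancelling it
  leaves two pairs. The six cases are the possible matchings between the sides of two
  triangles.\<close>

lemma mset_triple_eq_cases:
  assumes "{#x, y, z#} = {#x', y', z'#}"
  obtains "x = x'" "y = y'" "z = z'" | "x = x'" "y = z'" "z = y'"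
    | "x = y'" "y = x'" "z = z'" | "x = y'" "y = z'" "z = x'"
    | "x = z'" "y = x'" "z = y'" | "x = z'" "y = y'" "z = x'"
proof -
  have "x \<in># {#x', y', z'#}" unfolding assms[symmetric] by simp
  then consider "x = x'" | "x = y'" | "x = z'" by auto
  then show ?thesis
  proof cases
    case 1 with assms have "{#y, z#} = {#y', z'#}" by simp
    then show ?thesis using that(1,2) 1 by (cases rule: mset_pair_eq_cases) simp_all
  next
    case 2 with assms have "{#y, z#} = {#x', z'#}"
      by (metis add_mset_add_mset_same_iff add_mset_commute)
    then show ?thesis using that(3,4) 2 by (cases rule: mset_pair_eq_cases) simp_all
  next
    case 3 with assms have "{#y, z#} = {#x', y'#}"
      by (metis add_mset_add_mset_same_iff add_mset_commute)
    then show ?thesis using that(5,6) 3 by (cases rule: mset_pair_eq_cases) simp_all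
  qed
qed

text \<open>Every matching of the sides of two triangles is induced by a matching of their vertices.
  After relabelling the second triangle accordingly, corresponding distances agree and
  \<open>WD6_transitive\<close> applies.\<close>

lemma distances_eq_imp:
  assumes T: "{a, b, c} \<in> Omega3" and T': "{a', b', c'} \<in> Omega3"
    and eq: "distances a b c = distances a' b' c'"
  obtains g where "g \<in> carrier WD6" "(*v) g ` {a, b, c} = {a', b', c'}"
proof -
  have "\<exists>x y z. {x, y, z} = {a', b', c'} \<and> hamming a b = hamming x y \<and>
      hamming a c = hamming x z \<and> hamming b c = hamming y z"
    using eq[unfolded distances_def]
  proof (cases rule: mset_triple_eq_cases)
    \<comment> \<open>In each case a vertex is sent to the common endpoint of the two sides matched
      with the sides that meet at it.\<close>
    case 1 then show ?thesis by (intro exI[of _ a'] exI[of _ b'] exI[of _ c']) simp_all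
  next
    case 2 then show ?thesis
      by (intro exI[of _ b'] exI[of _ a'] exI[of _ c']) (simp_all add: hamming_commute insert_commute)
  next
    case 3 then show ?thesis
      by (intro exI[of _ c'] exI[of _ b'] exI[of _ a']) (simp_all add: hamming_commute insert_commute)
  next
    case 4 then show ?thesis
      by (intro exI[of _ b'] exI[of _ c'] exI[of _ a']) (simp_all add: hamming_commute insert_commute)
  next
    case 5 then show ?thesis
      by (intro exI[of _ c'] exI[of _ a'] exI[of _ b']) (simp_all add: hamming_commute insert_commute)
  next
    case 6 then show ?thesis
      by (intro exI[of _ a'] exI[of _ c'] exI[of _ b']) (simp_all add: hamming_commute insert_commute)
  qed
  then obtain x y z where xyz: "{x, y, z} = {a', b', c'}"
    "hamming a b = hamming x y" "hamming a c = hamming x z" "hamming b c = hamming y z"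
    by blast
  have "{x, y, z} \<in> Omega3" using T' xyz(1) by simp
  then obtain w where w: "w \<in> carrier WD6" "w *v a = x" "w *v b = y" "w *v c = z"
    using WD6_transitive[of a b c x y z] T xyz(2-4) unfolding triple_in_Omega3_iff by blast
  have "(*v) w ` {a, b, c} = {a', b', c'}"
    unfolding xyz(1)[symmetric] by (simp add: w(2-4))
  then show ?thesis by (rule that[OF w(1)])
qed

text \<open>The half-distances \<open>k\<close>, \<open>l\<close>, \<open>m\<close> lie between 1
  and 3 and satisfy the triangle inequalities. Each coordinate contributes to none or to exactly two
  of the three distances, whence \<open>k + l + m \<le> 6\<close>. Up to order this leaves (1,1,1),
  (2,1,1), (2,2,1), (2,2,2) and (3,2,1).\<close>

lemma distances_range:
  assumes "{a, b, c} \<in> Omega3"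
  shows "distances a b c \<in> {{#2,2,2#}, {#4,2,2#}, {#4,4,2#}, {#4,4,4#}, {#6,4,2#}}"
proof -
  have abc: "a \<in> Omega" "b \<in> Omega" "c \<in> Omega" "a \<noteq> b" "b \<noteq> c" "a \<noteq> c"
    using assms by (simp_all add: triple_in_Omega3_iff)
  obtain k l m where klm: "hamming a b = 2 * k" "hamming b c = 2 * l" "hamming a c = 2 * m"
    using even_hamming abc(1-3) by (metis evenE)
  note n = card_disagreement[OF abc(1-3)]
  have pos: "k > 0" "l > 0" "m > 0"
    using abc(4-6) klm hamming_eq_0_iff by (metis gr0I mult_0_right)+
  have "k + l + m \<le> 6" "k \<le> l + m" "l \<le> k + m" "m \<le> k + l" "k \<le> 3" "l \<le> 3" "m \<le> 3"
    using n klm by linarith+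
  with pos have "k \<in> {1,2,3}" "l \<in> {1,2,3}" "m \<in> {1,2,3}" by auto
  with \<open>k + l + m \<le> 6\<close> \<open>k \<le> l + m\<close> \<open>l \<le> k + m\<close> \<open>m \<le> k + l\<close> show ?thesis
    unfolding distances_def klm by (auto simp: add_mset_commute)
qed

section \<open>Representatives, encoded by their sets of negative coordinates\<close>

definition sign_vec :: "6 set \<Rightarrow> real^6" where
  "sign_vec S = (\<chi> i. if i \<in> S then -1 else 1)"

lemma sign_vec_in_Omega_iff: "sign_vec S \<in> Omega \<longleftrightarrow> even (card S)"
proof -
  have "{i. sign_vec S $ i = -1} = S" by (auto simp: sign_vec_def)
  then show ?thesis by (auto simp: Omega_def sign_vec_def)
qed

lemma hamming_sign_vec: "hamming (sign_vec S) (sign_vec T) = card ((S - T) \<union> (T - S))"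
proof -
  have "{i. sign_vec S $ i \<noteq> sign_vec T $ i} = (S - T) \<union> (T - S)"
    by (auto simp: sign_vec_def split: if_splits)
  then show ?thesis by (simp add: hamming_def)
qed

lemma distances_surj:
  assumes "M \<in> {{#2,2,2#}, {#4,2,2#}, {#4,4,2#}, {#4,4,4#}, {#6,4,2#}}"
  obtains a b c where "{a, b, c} \<in> Omega3" "distances a b c = M"
proof -
  \<comment> \<open>With the all-ones vector as first vertex, the distances from it are the
    cardinalities of \<open>S\<close> and \<open>T\<close>, and the remaining side is their
    symmetric difference. Positive distances make the three vertices distinct.\<close>
  have rep: "\<exists>a b c. {a, b, c} \<in> Omega3 \<and> distances a b c = {#k, l, m#}"
    if "card S = k" "card ((S - T) \<union> (T - S)) = l" "card T = m"
      "even k" "even m" "k > 0" "l > 0" "m > 0" for S T :: "6 set" and k l m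
  proof -
    have d: "hamming (sign_vec {}) (sign_vec S) = k" "hamming (sign_vec S) (sign_vec T) = l"
      "hamming (sign_vec {}) (sign_vec T) = m"
      using that by (simp_all add: hamming_sign_vec)
    then have "{sign_vec {}, sign_vec S, sign_vec T} \<in> Omega3"
      using that by (auto simp: triple_in_Omega3_iff sign_vec_in_Omega_iff simp flip: hamming_eq_0_iff)
    moreover have "distances (sign_vec {}) (sign_vec S) (sign_vec T) = {#k, l, m#}"
      by (simp add: distances_def d)
    ultimately show ?thesis by blast
  qed
  \<comment> \<open>The overlap of \<open>S\<close> and \<open>T\<close> adjusts the middle
    distance; distance 6 comes from complementary sets. In the index type the numeral 6 equals 0, so
    1 to 6 still name six different coordinates.\<close>
  have "\<exists>a b c. {a, b, c} \<in> Omega3 \<and> distances a b c = M"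
    using assms
      rep[where S = "{1, 2}" and T = "{2, 3}" and k = 2 and l = 2 and m = 2]
      rep[where S = "{1, 2}" and T = "{1, 2, 3, 4}" and k = 2 and l = 2 and m = 4]
      rep[where S = "{1, 2, 3, 4}" and T = "{2, 3, 4, 5}" and k = 4 and l = 2 and m = 4]
      rep[where S = "{1, 2, 3, 4}" and T = "{3, 4, 5, 6}" and k = 4 and l = 4 and m = 4]
      rep[where S = "{1, 2, 3, 4}" and T = "{5, 6}" and k = 4 and l = 6 and m = 2]
    by (auto simp: insert_Diff_if add_mset_commute)
  then show ?thesis using that by blast
qed

section \<open>Orbits and their distance multisets\<close>

lemma orbits_Omega3D:
  assumes "R \<in> orbits WD6 Omega3 diag_action" "T \<in> R" "T' \<in> R"
  obtains g where "g \<in> carrier WD6" "T' = (*v) g ` T" "T \<in> Omega3"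
proof -
  interpret group_action WD6 Omega3 diag_action by (rule group_action_Omega3)
  obtain x where x: "x \<in> Omega3" "R = orbit WD6 diag_action x"
    using assms(1) by (auto simp: orbits_def)
  then have E: "T \<in> Omega3" "T' \<in> Omega3"
    using assms element_image by (auto simp: orbit_def)
  \<comment> \<open>By symmetry and transitivity the orbit can be based at \<open>T\<close> instead
    of \<open>x\<close>.\<close>
  then have "T' \<in> orbit WD6 diag_action T"
    using assms x orbit_sym orbit_trans by blast
  then show ?thesis
    using that E by (auto simp: orbit_def diag_action_def)
qed

text \<open>Group elements preserve distances, and the multiset does not depend on how a triple is
  listed. Conversely \<open>distances_eq_imp\<close> supplies a group element, and the orbit of the
  first triple contains both.\<close>

lemma same_orbit_iff:
  assumes T: "{a, b, c} \<in> Omega3" and T': "{a', b', c'} \<in> Omega3"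
  shows "(\<exists>R\<in>orbits WD6 Omega3 diag_action. {a, b, c} \<in> R \<and> {a', b', c'} \<in> R) \<longleftrightarrow>
    distances a b c = distances a' b' c'"
proof
  assume "\<exists>R\<in>orbits WD6 Omega3 diag_action. {a, b, c} \<in> R \<and> {a', b', c'} \<in> R"
  then obtain g where g: "g \<in> carrier WD6" "{a', b', c'} = (*v) g ` {a, b, c}"
    using orbits_Omega3D by metis
  then have "distances a' b' c' = distances (g *v a) (g *v b) (g *v c)"
    by (intro distances_cong[OF T']) simp
  then show "distances a b c = distances a' b' c'"
    using distances_mult[OF g(1)] by simp
next
  interpret group_action WD6 Omega3 diag_action by (rule group_action_Omega3)
  assume "distances a b c = distances a' b' c'"
  then obtain g where g: "g \<in> carrier WD6" "(*v) g ` {a, b, c} = {a', b', c'}"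
    using distances_eq_imp[OF T T'] by blast
  then have "{a', b', c'} = diag_action g {a, b, c}"
    using T by (simp add: diag_action_def)
  then have "{a', b', c'} \<in> orbit WD6 diag_action {a, b, c}"
    using g(1) by (auto simp: orbit_def)
  then show "\<exists>R\<in>orbits WD6 Omega3 diag_action. {a, b, c} \<in> R \<and> {a', b', c'} \<in> R"
    using orbit_refl[OF T] T by (auto simp: orbits_def)
qed

text \<open>The distance multiset is constant on each orbit, so it descends to a function on orbits.
  It separates orbits by \<open>same_orbit_iff\<close>, and its image is found from
  \<open>distances_range\<close> and \<open>distances_surj\<close>.\<close>

lemma orbit_distances:
  obtains f where
    "bij_betw f (orbits WD6 Omega3 diag_action)
       {{#2,2,2#}, {#4,2,2#}, {#4,4,2#}, {#4,4,4#}, {#6,4,2#}}"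
    "\<And>R a b c. R \<in> orbits WD6 Omega3 diag_action \<Longrightarrow> {a, b, c} \<in> R \<Longrightarrow> f R = distances a b c"
proof -
  interpret group_action WD6 Omega3 diag_action by (rule group_action_Omega3)
  let ?Orb = "orbits WD6 Omega3 diag_action"
  have sub: "T \<in> Omega3" if "R \<in> ?Orb" "T \<in> R" for R T
    using orbits_Omega3D[OF that that(2)] by blast
  have same: "distances a b c = distances a' b' c'"
    if "R \<in> ?Orb" "{a, b, c} \<in> R" "{a', b', c'} \<in> R" for R a b c a' b' c'
    using same_orbit_iff[OF sub[OF that(1,2)] sub[OF that(1,3)]] that by blast
  \<comment> \<open>The choice is harmless: by \<open>same\<close>, all listings of all triples in
    an orbit give one multiset.\<close>
  define f where "f R = (SOME M. \<exists>a b c. {a, b, c} \<in> R \<and> M = distances a b c)" for R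
  have f: "f R = distances a b c" if R: "R \<in> ?Orb" "{a, b, c} \<in> R" for R a b c
    unfolding f_def by (rule some_equality) (use R same[OF R(1) _ R(2)] in blast)+
  have rep: "\<exists>a b c. {a, b, c} \<in> Omega3 \<and> {a, b, c} \<in> R \<and> f R = distances a b c"
    if R: "R \<in> ?Orb" for R
  proof -
    obtain T where "T \<in> Omega3" "T \<in> R"
      using R orbit_refl by (auto simp: orbits_def)
    moreover from this obtain a b c where "T = {a, b, c}"
      using Omega3_tripleE by blast
    ultimately show ?thesis using f[OF R] by blast
  qed
  have "inj_on f ?Orb"
  proof (rule inj_onI)
    fix R R' assume R: "R \<in> ?Orb" "R' \<in> ?Orb" "f R = f R'"
    obtain a b c where abc: "{a, b, c} \<in> Omega3" "{a, b, c} \<in> R" "f R = distances a b c"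
      using rep[OF R(1)] by blast
    obtain a' b' c' where abc': "{a', b', c'} \<in> Omega3" "{a', b', c'} \<in> R'" "f R' = distances a' b' c'"
      using rep[OF R(2)] by blast
    \<comment> \<open>Equal multisets put both triples in one orbit \<open>Q\<close>. It meets
      \<open>R\<close> and \<open>R'\<close>, and orbits are disjoint or equal, so all three
      coincide.\<close>
    obtain Q where Q: "Q \<in> ?Orb" "{a, b, c} \<in> Q" "{a', b', c'} \<in> Q"
      using same_orbit_iff[OF abc(1) abc'(1)] R(3) abc(3) abc'(3) by auto
    then show "R = R'"
      using disjoint_union[OF R(1) Q(1)] disjoint_union[OF R(2) Q(1)] abc(2) abc'(2) by blast
  qed
  moreover have "f ` ?Orb = {{#2,2,2#}, {#4,2,2#}, {#4,4,2#}, {#4,4,4#}, {#6,4,2#}}"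
  proof (intro subset_antisym subsetI)
    fix M assume "M \<in> f ` ?Orb"
    then show "M \<in> {{#2,2,2#}, {#4,2,2#}, {#4,4,2#}, {#4,4,4#}, {#6,4,2#}}"
      using rep distances_range by fastforce
  next
    fix M :: "nat multiset"
    assume "M \<in> {{#2,2,2#}, {#4,2,2#}, {#4,4,2#}, {#4,4,4#}, {#6,4,2#}}"
    then obtain a b c where abc: "{a, b, c} \<in> Omega3" "distances a b c = M"
      by (rule distances_surj)
    then obtain R where "R \<in> ?Orb" "{a, b, c} \<in> R"
      using same_orbit_iff[OF abc(1) abc(1)] by blast
    then show "M \<in> f ` ?Orb"
      using f[of R a b c] abc(2) by auto
  qed
  ultimately show ?thesis
    using f by (intro that[of f]) (simp_all add: bij_betw_def)
qed

theorem proposition5p5: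
  "group_action WD6 Omega3 diag_action
   \<and>
   (\<forall>a b :: nat \<Rightarrow> real^6.
      {a 1, a 2, a 3} \<in> Omega3 \<longrightarrow> {b 1, b 2, b 3} \<in> Omega3 \<longrightarrow>
      (\<forall>i\<in>{1,2,3}. \<forall>j\<in>{1,2,3}. hamming (a i) (a j) = hamming (b i) (b j)) \<longrightarrow>
      (\<exists>w\<in>carrier WD6. \<forall>i\<in>{1,2,3}. w *v a i = b i))
   \<and>
   (\<forall>a b c a' b' c' :: real^6.
      {a, b, c} \<in> Omega3 \<longrightarrow> {a', b', c'} \<in> Omega3 \<longrightarrow>
      ((\<exists>R\<in>orbits WD6 Omega3 diag_action. {a, b, c} \<in> R \<and> {a', b', c'} \<in> R) \<longleftrightarrow>
       {#hamming a b, hamming b c, hamming a c#} =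
       {#hamming a' b', hamming b' c', hamming a' c'#}))
   \<and>
   card (orbits WD6 Omega3 diag_action) = 5
   \<and>
   (\<exists>f. bij_betw f (orbits WD6 Omega3 diag_action)
          {{#2,2,2#}, {#4,2,2#}, {#4,4,2#}, {#4,4,4#}, {#6,4,2#}} \<and>
        (\<forall>R\<in>orbits WD6 Omega3 diag_action. \<forall>a b c. {a, b, c} \<in> R \<longrightarrow>
           f R = {#hamming a b, hamming b c, hamming a c#}))"
proof (intro conjI)
  show "group_action WD6 Omega3 diag_action" by (rule group_action_Omega3)
  show "\<forall>a b :: nat \<Rightarrow> real^6.
      {a 1, a 2, a 3} \<in> Omega3 \<longrightarrow> {b 1, b 2, b 3} \<in> Omega3 \<longrightarrow>
      (\<forall>i\<in>{1,2,3}. \<forall>j\<in>{1,2,3}. hamming (a i) (a j) = hamming (b i) (b j)) \<longrightarrow>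
      (\<exists>w\<in>carrier WD6. \<forall>i\<in>{1,2,3}. w *v a i = b i)"
  proof (intro allI impI)
    fix a b :: "nat \<Rightarrow> real^6"
    assume T: "{a 1, a 2, a 3} \<in> Omega3" "{b 1, b 2, b 3} \<in> Omega3"
      and d: "\<forall>i\<in>{1,2,3}. \<forall>j\<in>{1,2,3}. hamming (a i) (a j) = hamming (b i) (b j)"
    obtain w where "w \<in> carrier WD6" "w *v a 1 = b 1" "w *v a 2 = b 2" "w *v a 3 = b 3"
      by (rule WD6_transitive[of "a 1" "a 2" "a 3" "b 1" "b 2" "b 3"])
        (use T d in \<open>simp_all add: triple_in_Omega3_iff\<close>)
    then show "\<exists>w\<in>carrier WD6. \<forall>i\<in>{1,2,3}. w *v a i = b i" by auto
  qed
  show "\<forall>a b c a' b' c' :: real^6.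
      {a, b, c} \<in> Omega3 \<longrightarrow> {a', b', c'} \<in> Omega3 \<longrightarrow>
      ((\<exists>R\<in>orbits WD6 Omega3 diag_action. {a, b, c} \<in> R \<and> {a', b', c'} \<in> R) \<longleftrightarrow>
       {#hamming a b, hamming b c, hamming a c#} =
       {#hamming a' b', hamming b' c', hamming a' c'#})"
    using same_orbit_iff unfolding distances_def by blast
  obtain f where f: "bij_betw f (orbits WD6 Omega3 diag_action)
       {{#2,2,2#}, {#4,2,2#}, {#4,4,2#}, {#4,4,4#}, {#6,4,2#}}"
    "\<And>R a b c. R \<in> orbits WD6 Omega3 diag_action \<Longrightarrow> {a, b, c} \<in> R \<Longrightarrow> f R = distances a b c"
    using orbit_distances by blast
  show "card (orbits WD6 Omega3 diag_action) = 5"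
    \<comment> \<open>It remains to check that the five listed multisets are pairwise
      distinct.\<close>
    using bij_betw_same_card[OF f(1)] by (simp add: add_eq_conv_ex)
  show "\<exists>f. bij_betw f (orbits WD6 Omega3 diag_action)
          {{#2,2,2#}, {#4,2,2#}, {#4,4,2#}, {#4,4,4#}, {#6,4,2#}} \<and>
        (\<forall>R\<in>orbits WD6 Omega3 diag_action. \<forall>a b c. {a, b, c} \<in> R \<longrightarrow>
           f R = {#hamming a b, hamming b c, hamming a c#})"
    using f unfolding distances_def by blast
qed

end
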